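(* Let $M,N\ge 1$ be integers, $T>0$ a real number, $y_1,\dots,y_M\in\{+1,-1\}$, and $H\in\{+1,-1\}^{M\times N}$ with rows $H_1,\dots,H_M$ and entries $H_{ij}$. The Lagrange dual of the AdaBoost$_{\ell_1}$ problem $$\min_{w\in\mathbb{R}^N,\ z\in\mathbb{R}^M}\ \log\Bigl(\sum_{i=1}^M \exp z_i\Bigr)\quad\text{s.t.}\quad z_i=-y_iH_iw\ (i=1,\dots,M),\quad w\ge 0,\quad \mathbf{1}^\top w=\tfrac1T,$$ is the Shannon entropy maximization problem $$\max_{r\in\mathbb{R},\ u\in\mathbb{R}^M}\ \frac{r}{T}-\sum_{i=1}^M u_i\log u_i\quad\text{s.t.}\quad \sum_{i=1}^M u_iy_iH_{ij}\le -r\ (j=1,\dots,N),\quad u\ge 0,\quad \mathbf{1}^\top u=1 .$$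
   Context: Setting: training examples $x_1,\dots,x_M$ with labels $y_i\in\{+1,-1\}$, weak classifiers $h_1,\dots,h_N$ with values in $\{+1,-1\}$, and $H_{ij}=h_j(x_i)$; the row vector $H_i=[H_{i1}\ \cdots\ H_{iN}]$ is the $i$-th row of $H$. The $\ell_1$-norm regularized AdaBoost (AdaBoost$_{\ell_1}$) problem is: minimize $\log\bigl(\sum_{i=1}^M\exp(-y_iH_iw)\bigr)$ over $w\in\mathbb{R}^N$ subject to $w\ge 0$, $\mathbf{1}^\top w=1/T$. It is written equivalently with the auxiliary variables $z_i=-y_iH_iw$, and the dual is taken of this reformulation. Vector inequalities are componentwise, $\mathbf{1}$ is the all-ones vector, and $0\log 0=0$. The Lagrange dual is formed with the Lagrangian $$L(w,z,u,q,r)=\log\Bigl(\sum_{i=1}^M\exp z_i\Bigr)-\sum_{i=1}^M u_i(z_i+y_iH_iw)-q^\top w-r\bigl(\mathbf{1}^\top w-\tfrac1T\bigr),$$ with multipliers $u\in\mathbb{R}^M$, $q\in\mathbb{R}^N$ with $q\ge0$, and $r\in\mathbb{R}$. The dual function is $g(u,q,r)=\inf_{w\in\mathbb{R}^N,z\in\mathbb{R}^M}L(w,z,u,q,r)\in[-\infty,\infty)$, and the dual problem is to maximize $g(u,q,r)$ over $u$, $r$ and $q\ge0$. "The dual is" the stated problem means: after making the condition $g>-\infty$ explicit as constraints and eliminating $q$, the dual problem becomes the stated one. That is, for every $(u,r)$, $\sup_{q\ge 0}g(u,q,r)$ equals the stated objective if $(u,r)$ satisfies the stated constraints, and equals $-\infty$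 otherwise. *)

theory Defs
  imports "HOL-Analysis.Analysis"
begin

text \<open>
  Lagrangian and dual function of a problem in the form: minimize \<open>f x\<close> over all \<open>x\<close> subject to
  \<open>h x = 0\<close> and \<open>c x \<ge> 0\<close> (componentwise). The constraint terms are subtracted, so the
  inequality multiplier \<open>q\<close> ranges over \<open>q \<ge> 0\<close>, and the equality multiplier \<open>\<nu>\<close> is free.
\<close>

definition lagrangian ::
  "('x \<Rightarrow> real) \<Rightarrow> ('x \<Rightarrow> 'e) \<Rightarrow> ('x \<Rightarrow> real ^ 'n) \<Rightarrow> 'x \<Rightarrow> 'e::real_inner \<Rightarrow> real ^ 'n \<Rightarrow> real"
  where "lagrangian f h c x \<nu> q = f x - \<nu> \<bullet> h x - q \<bullet> c x"

definition dual_function ::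
  "('x \<Rightarrow> real) \<Rightarrow> ('x \<Rightarrow> 'e) \<Rightarrow> ('x \<Rightarrow> real ^ 'n) \<Rightarrow> 'e::real_inner \<Rightarrow> real ^ 'n \<Rightarrow> ereal"
  where "dual_function f h c \<nu> q = (INF x. ereal (lagrangian f h c x \<nu> q))"

text \<open>
  The \<open>l\<^sub>1\<close>-regularized AdaBoost problem in the variable \<open>x = (w, z)\<close>. Its equality constraints
  \<open>z\<^sub>i + y\<^sub>i H\<^sub>i w = 0\<close> and \<open>1\<^sup>T w - 1/T = 0\<close> are paired into one vector-valued constraint, so
  their multiplier is the pair \<open>\<nu> = (u, r)\<close>.
\<close>

definition adaboost_objective :: "(real ^ 'n) \<times> (real ^ 'm) \<Rightarrow> real"
  where "adaboost_objective = (\<lambda>(w, z). ln (\<Sum>i\<in>UNIV. exp (z $ i)))"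

definition adaboost_eq ::
  "real \<Rightarrow> real ^ 'm \<Rightarrow> real ^ 'n ^ 'm \<Rightarrow> (real ^ 'n) \<times> (real ^ 'm) \<Rightarrow> (real ^ 'm) \<times> real"
  where "adaboost_eq T y H =
    (\<lambda>(w, z). (\<chi> i. z $ i + y $ i * (H *v w) $ i, (\<Sum>j\<in>UNIV. w $ j) - 1 / T))"

definition adaboost_ineq :: "(real ^ 'n) \<times> (real ^ 'm) \<Rightarrow> real ^ 'n"
  where "adaboost_ineq = (\<lambda>(w, z). w)"

lemma adaboost_lagrangian:
  "lagrangian adaboost_objective (adaboost_eq T y H) adaboost_ineq (w, z) (u, r) q =
    ln (\<Sum>i\<in>UNIV. exp (z $ i))
    - (\<Sum>i\<in>UNIV. u $ i * (z $ i + y $ i * (\<Sum>j\<in>UNIV. H $ i $ j * w $ j)))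
    - (\<Sum>j\<in>UNIV. q $ j * w $ j) - r * ((\<Sum>j\<in>UNIV. w $ j) - 1 / T)"
  by (simp add: lagrangian_def adaboost_objective_def adaboost_eq_def adaboost_ineq_def
      inner_vec_def matrix_vector_mult_def)

end

theory Submission
  imports Defs
begin

text \<open>
  The Lagrangian splits as \<open>(log (\<Sum> exp z\<^sub>i) - u \<bullet> z) - (q + r 1 + a) \<bullet> w + r/T\<close> with
  \<open>a\<^sub>j = \<Sum>\<^sub>i u\<^sub>i y\<^sub>i H\<^sub>i\<^sub>j\<close>. The linear part in \<open>w\<close> is bounded below only if \<open>q = - r 1 - a\<close>, which
  is compatible with \<open>q \<ge> 0\<close> iff \<open>a \<le> - r 1\<close>. The infimum over \<open>z\<close> is minus the convex conjugate
  of log-sum-exp: the entropy of \<open>u\<close> on the probability simplex (by Gibbs' inequality, with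
  near-minimizers \<open>z\<^sub>i = log (u\<^sub>i + \<epsilon>)\<close>) and \<open>-\<infinity>\<close> off it.
\<close>

text \<open>Serves every unboundedness argument below: it is enough to give, for each
  \<open>t\<close>, a point where the value has dropped at rate \<open>b\<close> from a fixed
  level.\<close>

lemma INF_ereal_eq_minus_infty:
  fixes f :: "'a \<Rightarrow> real"
  assumes "b > 0" and line: "\<And>t. t \<ge> 0 \<Longrightarrow> \<exists>x. f x \<le> a - t * b"
  shows "(INF x. ereal (f x)) = - \<infinity>"
proof (rule ereal_bot)
  fix B :: real
  \<comment> \<open>The bound \<open>a - t * b\<close> reaches \<open>B\<close> at
    \<open>(a - B) / b\<close>; the maximum with 0 keeps \<open>t\<close> in the range of
    \<open>line\<close>.\<close>
  define t where "t = max 0 ((a - B) / b)"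
  have "(a - B) / b \<le> t" "t \<ge> 0" by (auto simp: t_def)
  then have "a - t * b \<le> B" using \<open>b > 0\<close> by (simp add: field_simps)
  moreover obtain x where "f x \<le> a - t * b" using line[OF \<open>t \<ge> 0\<close>] by blast
  ultimately have "ereal (f x) \<le> ereal B" by simp
  then show "(INF x. ereal (f x)) \<le> ereal B" by (rule INF_lower2[OF UNIV_I])
qed

text \<open>Apply \<open>ln x \<le> x - 1\<close> to the ratio of the softmax weight
  \<open>exp (z i) / S\<close> to \<open>u i\<close>, and average with weights \<open>u i\<close>.
  Both weight families sum to 1, so the right-hand sides cancel.\<close>

lemma gibbs_log_sum_exp:
  fixes u z :: "'m::finite \<Rightarrow> real"
  assumes nonneg: "\<And>i. 0 \<le> u i" and total: "(\<Sum>i\<in>UNIV. u i) = 1"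
  shows "- (\<Sum>i\<in>UNIV. u i * ln (u i)) \<le> ln (\<Sum>i\<in>UNIV. exp (z i)) - (\<Sum>i\<in>UNIV. u i * z i)"
proof -
  define S where "S = (\<Sum>i\<in>UNIV. exp (z i))"
  have S: "S > 0" unfolding S_def by (rule sum_pos) auto
  have summand: "u i * (z i - ln (u i) - ln S) \<le> exp (z i) / S - u i" for i
  proof (cases "u i = 0")
    case True
    then show ?thesis using S by simp
  next
    case False
    then have u: "u i > 0" using nonneg[of i] by simp
    have "z i - ln (u i) - ln S = ln (exp (z i) / (u i * S))"
      using u S by (simp add: ln_div ln_mult)
    also have "\<dots> \<le> exp (z i) / (u i * S) - 1"
      using u S by (intro ln_le_minus_one) simp
    finally have "u i * (z i - ln (u i) - ln S) \<le> u i * (exp (z i) / (u i * S) - 1)"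
      using u by (intro mult_left_mono) auto
    also have "\<dots> = exp (z i) / S - u i" using u by (simp add: field_simps)
    finally show ?thesis .
  qed
  have "(\<Sum>i\<in>UNIV. u i * (z i - ln (u i) - ln S)) \<le> (\<Sum>i\<in>UNIV. exp (z i) / S - u i)"
    by (intro sum_mono summand)
  also have "\<dots> = 0"
    using S total by (simp add: sum_subtractf flip: sum_divide_distrib S_def)
  finally have "(\<Sum>i\<in>UNIV. u i * z i) - (\<Sum>i\<in>UNIV. u i * ln (u i)) - (\<Sum>i\<in>UNIV. u i) * ln S \<le> 0"
    by (simp add: right_diff_distrib sum_subtractf sum_distrib_right)
  then show ?thesis using total by (simp add: S_def)
qed

text \<open>The natural minimizer \<open>ln (u i)\<close> would have to be minus infinity where
  \<open>u i = 0\<close>, hence the shift by \<epsilon>. It raises the sum of exponentials only to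
  \<open>1 + CARD('m) * \<epsilon>\<close>, and by monotonicity of \<open>ln\<close> it can only
  help in the subtracted term.\<close>

lemma log_sum_exp_near_minimizer:
  fixes u :: "'m::finite \<Rightarrow> real"
  assumes nonneg: "\<And>i. 0 \<le> u i" and total: "(\<Sum>i\<in>UNIV. u i) = 1" and "\<epsilon> > 0"
  shows "ln (\<Sum>i\<in>UNIV. exp (ln (u i + \<epsilon>))) - (\<Sum>i\<in>UNIV. u i * ln (u i + \<epsilon>))
    \<le> real CARD('m) * \<epsilon> - (\<Sum>i\<in>UNIV. u i * ln (u i))"
proof -
  have pos: "u i + \<epsilon> > 0" for i using nonneg[of i] \<open>\<epsilon> > 0\<close> by linarith
  have "ln (\<Sum>i\<in>UNIV. exp (ln (u i + \<epsilon>))) = ln (1 + real CARD('m) * \<epsilon>)"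
    using total by (simp add: exp_ln[OF pos] sum.distrib)
  also have "\<dots> \<le> real CARD('m) * \<epsilon>"
    using \<open>\<epsilon> > 0\<close> by (intro ln_add_one_self_le_self) simp
  finally have "ln (\<Sum>i\<in>UNIV. exp (ln (u i + \<epsilon>))) \<le> real CARD('m) * \<epsilon>" .
  moreover have "(\<Sum>i\<in>UNIV. u i * ln (u i)) \<le> (\<Sum>i\<in>UNIV. u i * ln (u i + \<epsilon>))"
  proof (rule sum_mono)
    fix i
    show "u i * ln (u i) \<le> u i * ln (u i + \<epsilon>)"
    proof (cases "u i = 0")
      case False
      then have "u i > 0" using nonneg[of i] by simp
      then show ?thesis using \<open>\<epsilon> > 0\<close> by (intro mult_left_mono) auto
    qed simp
  qed
  ultimately show ?thesis by linarith
qed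

text \<open>The constant \<open>c\<close> is kept inside the infimum so that the dual function,
  where it is \<open>r / T\<close>, can be rewritten directly.\<close>

lemma INF_log_sum_exp_minus_linear:
  fixes u :: "real ^ 'm"
  shows "(INF z::real ^ 'm. ereal (c + (ln (\<Sum>i\<in>UNIV. exp (z $ i)) - (\<Sum>i\<in>UNIV. u $ i * z $ i)))) =
    (if (\<forall>i. 0 \<le> u $ i) \<and> (\<Sum>i\<in>UNIV. u $ i) = 1
     then ereal (c - (\<Sum>i\<in>UNIV. u $ i * ln (u $ i))) else - \<infinity>)"
    (is "(INF z. ereal (?f z)) = _")
proof -
  consider (simplex) "\<forall>i. 0 \<le> u $ i" "(\<Sum>i\<in>UNIV. u $ i) = 1"
    | (total) "(\<Sum>i\<in>UNIV. u $ i) \<noteq> 1" | (neg) k where "u $ k < 0"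
    by (meson not_le)
  then show ?thesis
  proof cases
    case simplex
    let ?v = "c - (\<Sum>i\<in>UNIV. u $ i * ln (u $ i))"
    have "(INF z. ereal (?f z)) = ereal ?v"
    proof (rule antisym)
      show "(INF z. ereal (?f z)) \<le> ereal ?v"
      proof (rule ereal_le_epsilon2)
        fix e :: real assume "e > 0"
        \<comment> \<open>Chosen so that the error \<open>CARD('m) * \<epsilon>\<close> of the
          near-minimizer is exactly \<open>e\<close>.\<close>
        define \<epsilon> where "\<epsilon> = e / CARD('m)"
        have \<epsilon>: "\<epsilon> > 0" "real CARD('m) * \<epsilon> = e" using \<open>e > 0\<close> by (auto simp: \<epsilon>_def)
        have "?f (\<chi> i. ln (u $ i + \<epsilon>)) \<le> ?v + e"
          using log_sum_exp_near_minimizer[of "\<lambda>i. u $ i" \<epsilon>] simplex \<epsilon> by simp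
        then have "ereal (?f (\<chi> i. ln (u $ i + \<epsilon>))) \<le> ereal ?v + ereal e" by simp
        then show "(INF z. ereal (?f z)) \<le> ereal ?v + ereal e"
          by (rule INF_lower2[OF UNIV_I])
      qed
      show "ereal ?v \<le> (INF z. ereal (?f z))"
      proof (rule INF_greatest)
        fix z :: "real ^ 'm"
        show "ereal ?v \<le> ereal (?f z)"
          using gibbs_log_sum_exp[of "\<lambda>i. u $ i" "\<lambda>i. z $ i"] simplex by simp
      qed
    qed
    then show ?thesis using simplex by simp
  next
    case total
    let ?d = "1 - (\<Sum>i\<in>UNIV. u $ i)"
    have "(INF z. ereal (?f z)) = - \<infinity>"
    proof (rule INF_ereal_eq_minus_infty)
      show "\<bar>?d\<bar> > 0" using total by simp
      fix t :: real
      \<comment> \<open>On constant vectors log-sum-exp grows with slope 1 and the linear term with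
        slope \<open>\<Sum>i\<in>UNIV. u $ i\<close>, so \<open>?f\<close> is affine with nonzero
        slope \<open>?d\<close>; \<open>s\<close> then moves against its sign.\<close>
      have "?f (\<chi> i. s) = c + ln CARD('m) + s * ?d" for s
        by (simp add: ln_mult algebra_simps flip: sum_distrib_left)
      from this[of "- t * sgn ?d"]
      have "?f (\<chi> i. - t * sgn ?d) = c + ln CARD('m) - t * \<bar>?d\<bar>"
        by (simp add: abs_sgn mult.assoc mult.commute mult.left_commute)
      then show "\<exists>z. ?f z \<le> c + ln CARD('m) - t * \<bar>?d\<bar>" by (intro exI) (rule eq_refl)
    qed
    then show ?thesis using total by simp
  next
    case neg
    have "(INF z. ereal (?f z)) = - \<infinity>"
    proof (rule INF_ereal_eq_minus_infty)
      show "- u $ k > 0" using neg by simp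
      fix t :: real assume "t \<ge> 0"
      \<comment> \<open>Lowering only coordinate \<open>k\<close> keeps every exponential at most 1,
        while the linear term contributes \<open>t * u $ k\<close>, which tends to minus
        infinity.\<close>
      define z :: "real ^ 'm" where "z = axis k (- t)"
      have "(\<Sum>i\<in>UNIV. exp (z $ i)) \<le> (\<Sum>i\<in>(UNIV::'m set). 1)"
        using \<open>t \<ge> 0\<close> by (intro sum_mono) (simp add: z_def axis_def)
      moreover have "(\<Sum>i\<in>UNIV. exp (z $ i)) > 0" by (rule sum_pos) auto
      ultimately have "ln (\<Sum>i\<in>UNIV. exp (z $ i)) \<le> ln CARD('m)" by simp
      moreover have "(\<Sum>i\<in>UNIV. u $ i * z $ i) = - t * u $ k"
        by (simp add: z_def axis_def if_distrib cong: if_cong)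
      ultimately have "?f z \<le> c + ln CARD('m) - t * - u $ k" by simp
      then show "\<exists>z. ?f z \<le> c + ln CARD('m) - t * - u $ k" ..
    qed
    then show ?thesis using neg by (auto simp: not_le)
  qed
qed

lemma adaboost_lagrangian_split:
  "lagrangian adaboost_objective (adaboost_eq T y H) adaboost_ineq (w, z) (u, r) q =
    r / T + (ln (\<Sum>i\<in>UNIV. exp (z $ i)) - (\<Sum>i\<in>UNIV. u $ i * z $ i))
    - (\<Sum>j\<in>UNIV. (q $ j + r + (\<Sum>i\<in>UNIV. u $ i * y $ i * H $ i $ j)) * w $ j)"
proof -
  have "(\<Sum>i\<in>UNIV. u $ i * (y $ i * (\<Sum>j\<in>UNIV. H $ i $ j * w $ j))) =
      (\<Sum>j\<in>UNIV. (\<Sum>i\<in>UNIV. u $ i * y $ i * H $ i $ j) * w $ j)"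
    unfolding sum_distrib_left sum_distrib_right
    by (subst sum.swap) (simp add: mult.assoc)
  then show ?thesis
    unfolding adaboost_lagrangian
    by (simp add: distrib_left distrib_right right_diff_distrib sum.distrib flip: sum_distrib_left)
qed

lemma adaboost_dual_function:
  fixes y u :: "real ^ 'm" and H :: "real ^ 'n ^ 'm"
  shows "dual_function adaboost_objective (adaboost_eq T y H) adaboost_ineq (u, r) q =
    (if (\<forall>j. q $ j + r + (\<Sum>i\<in>UNIV. u $ i * y $ i * H $ i $ j) = 0)
        \<and> (\<forall>i. 0 \<le> u $ i) \<and> (\<Sum>i\<in>UNIV. u $ i) = 1
     then ereal (r / T - (\<Sum>i\<in>UNIV. u $ i * ln (u $ i))) else - \<infinity>)"
proof -
  define d where "d j = q $ j + r + (\<Sum>i\<in>UNIV. u $ i * y $ i * H $ i $ j)" for j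
  let ?g = "\<lambda>z::real ^ 'm. ln (\<Sum>i\<in>UNIV. exp (z $ i)) - (\<Sum>i\<in>UNIV. u $ i * z $ i)"
  have dual: "dual_function adaboost_objective (adaboost_eq T y H) adaboost_ineq (u, r) q =
      (INF x. ereal ((\<lambda>(w, z). r / T + ?g z - (\<Sum>j\<in>UNIV. d j * w $ j)) x))"
    unfolding dual_function_def
    by (intro INF_cong refl) (auto simp: adaboost_lagrangian_split d_def)
  show ?thesis
  proof (cases "\<forall>j. d j = 0")
    case True
    \<comment> \<open>With \<open>d = 0\<close> the value no longer depends on
      \<open>w\<close>.\<close>
    then have "(INF x. ereal ((\<lambda>(w::real ^ 'n, z). r / T + ?g z - (\<Sum>j\<in>UNIV. d j * w $ j)) x)) =
        (INF z. ereal (r / T + ?g z))"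
      by (auto intro!: INF_eq)
    then show ?thesis
      using True unfolding dual INF_log_sum_exp_minus_linear by (simp add: d_def)
  next
    case False
    then obtain k where k: "d k \<noteq> 0" by blast
    have "(INF x. ereal ((\<lambda>(w::real ^ 'n, z). r / T + ?g z - (\<Sum>j\<in>UNIV. d j * w $ j)) x)) = - \<infinity>"
    proof (rule INF_ereal_eq_minus_infty)
      show "\<bar>d k\<bar> > 0" using k by simp
      fix t :: real
      \<comment> \<open>Hold \<open>z\<close> at 0 and move \<open>w\<close> along axis
        \<open>k\<close> in the direction of the sign of \<open>d k\<close>.\<close>
      have "(\<Sum>j\<in>UNIV. d j * axis k (t * sgn (d k)) $ j) = t * \<bar>d k\<bar>"
        by (simp add: axis_def if_distrib abs_sgn mult.left_commute cong: if_cong)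
      then show "\<exists>x. (case x of (w::real ^ 'n, z) \<Rightarrow> r / T + ?g z - (\<Sum>j\<in>UNIV. d j * w $ j))
          \<le> r / T + ?g 0 - t * \<bar>d k\<bar>"
        by (intro exI[of _ "(axis k (t * sgn (d k)), 0)"]) simp
    qed
    then show ?thesis using k unfolding dual by (auto simp: d_def)
  qed
qed

theorem theorem3p1:
  fixes T :: real and y :: "real ^ 'm" and H :: "real ^ 'n ^ 'm"
    and u :: "real ^ 'm" and r :: real
  assumes "T > 0"
    and "\<And>i. y $ i \<in> {1, -1}"
    and "\<And>i j. H $ i $ j \<in> {1, -1}"
  shows "(SUP q\<in>{q. \<forall>j. 0 \<le> q $ j}.
            dual_function adaboost_objective (adaboost_eq T y H) adaboost_ineq (u, r) q) =
         (if (\<forall>j. (\<Sum>i\<in>UNIV. u $ i * y $ i * H $ i $ j) \<le> - r)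
             \<and> (\<forall>i. 0 \<le> u $ i) \<and> (\<Sum>i\<in>UNIV. u $ i) = 1
          then ereal (r / T - (\<Sum>i\<in>UNIV. u $ i * ln (u $ i)))
          else - \<infinity>)"
    (is "(SUP q\<in>?Q. ?D q) = ?v")
proof (rule antisym)
  show "(SUP q\<in>?Q. ?D q) \<le> ?v"
  proof (rule SUP_least)
    fix q :: "real ^ 'n" assume "q \<in> ?Q"
    \<comment> \<open>A finite value of \<open>?D q\<close> thus forces \<open>(u, r)\<close> to be
      feasible, and then it equals \<open>?v\<close>.\<close>
    then have "(\<Sum>i\<in>UNIV. u $ i * y $ i * H $ i $ j) \<le> - r"
      if "q $ j + r + (\<Sum>i\<in>UNIV. u $ i * y $ i * H $ i $ j) = 0" for j
      using that by (simp add: eq_neg_iff_add_eq_0 add_eq_0_iff)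
    then show "?D q \<le> ?v" unfolding adaboost_dual_function by auto
  qed
  \<comment> \<open>The only multiplier at which the dual function can be finite; it is the slack of
    the inequality constraints, so it lies in \<open>?Q\<close> exactly when they hold.\<close>
  define q :: "real ^ 'n" where "q = (\<chi> j. - r - (\<Sum>i\<in>UNIV. u $ i * y $ i * H $ i $ j))"
  show "?v \<le> (SUP q\<in>?Q. ?D q)"
  proof (cases "\<forall>j. (\<Sum>i\<in>UNIV. u $ i * y $ i * H $ i $ j) \<le> - r")
    case True
    then have "q \<in> ?Q" by (simp add: q_def)
    moreover have "?v \<le> ?D q" using True unfolding adaboost_dual_function by (simp add: q_def)
    ultimately show ?thesis by (rule SUP_upper2)
  qed auto
qed

end
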